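(* Let $n\ge 2$, let $G=[g_{ij}]$ be an interaction network on $N=\{1,\dots,n\}$, let $\tau_x,\tau_y>0$, and let $\gamma=\tau_x/(\tau_x+\tau_y)$. The equilibrium degree of information sharing is inefficiently low, i.e. $$U_1(\tau_x,\tau_y,G)<U_1^\dagger(\tau_x,\tau_y,G)\quad\text{and}\quad W^\dagger(\tau_x,\tau_y,G)<W(\tau_x,\tau_y,G),$$ if and only if the following two conditions hold: $$c_1^2(\gamma,G)-\sum_{j\ne 1}g_{1j}\,c_j(\gamma,G)\big(c_j(\gamma,G)-2\big)<1,$$ $$1+d_1^{in}<\sum_{i\in N}c_i(\gamma,G)\Big((1-d_i^{in})\,c_i(\gamma,G)+2d_i^{in}\Big),$$ where $d_i^{in}=\sum_{j\ne i}g_{ji}$.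
   Context: Interaction network: an $n\times n$ real matrix $G=[g_{ij}]$ with $g_{ij}\ge 0$, $g_{ii}=0$, and $d_i^{out}:=\sum_{j\ne i}g_{ij}<1$ for all $i\in N$. Payoffs: agent $i$ chooses $a_i\in\mathbb{R}$; with $a=(a_j)_{j\in N}$ and common state $\theta\in\mathbb{R}$, $$u_i(a,\theta)=-\Big(1-\sum_{j\neq i}g_{ij}\Big)(a_i-\theta)^2-\sum_{j\ne i}g_{ij}(a_i-a_j)^2 .$$ Signals: $\theta$ has the improper uniform prior on $\mathbb{R}$; $x_i=\theta+\varepsilon_i$ for $i\in N$ and $y=\theta+\varepsilon_y$, where $\varepsilon_i\sim N(0,\tau_x^{-1})$, $\varepsilon_y\sim N(0,\tau_y^{-1})$, and $\theta,\varepsilon_1,\dots,\varepsilon_n,\varepsilon_y$ are jointly independent. $\gamma=\tau_x/(\tau_x+\tau_y)\in(0,1)$. Information sharing: agent 1 initially possesses the signal $y$ and, before signals are realized, chooses at no cost whether to make $y$ public or keep it private. If $y$ is public, every agent $i$ observes $(x_i,y)$. The resulting game has a unique linear Bayesian Nash equilibrium $a_i^*=(1-\gamma)c_i(\gamma,G)\,y+\big(1-(1-\gamma)c_i(\gamma,G)\big)x_i$, where $\mathbf{c}(\gamma,G)=(c_1(\gamma,G),\dots,c_n(\gamma,G))'=(I-\gamma G)^{-1}\mathbf{1}$ is the Katz-Bonacich centrality vector ($\mathbf{1}$ the all-ones vector). Let $U_1(\tau_x,\tau_y,G)=\mathbb{E}[u_1(a^*,\theta)]$ and $W(\tau_x,\tau_y,G)=\sum_{i\in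 N}\mathbb{E}[u_i(a^*,\theta)]$. If $y$ is kept private, agent 1 observes $(x_1,y)$ and each agent $i\ne 1$ observes only $x_i$. The resulting game has a unique linear Bayesian Nash equilibrium $a_1^\dagger=(1-\gamma)y+\gamma x_1$ and $a_i^\dagger=x_i$ for $i\ne1$. Let $U_1^\dagger(\tau_x,\tau_y,G)=\mathbb{E}[u_1(a^\dagger,\theta)]$ and $W^\dagger(\tau_x,\tau_y,G)=\sum_{i\in N}\mathbb{E}[u_i(a^\dagger,\theta)]$. All these expectations are over the noise terms; the equilibrium payoffs depend only on the noise terms, not on $\theta$. *)

theory Defs
  imports "HOL-Probability.Probability"
begin

text \<open>
  The agents are the elements of a finite type \<open>'n\<close>, so \<open>n = CARD('n)\<close>;
  agent 1, the original owner of the signal \<open>y\<close>, is an arbitrary distinguished element.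
\<close>

definition out_degree :: "real^'n^'n \<Rightarrow> 'n \<Rightarrow> real" where
  "out_degree G i = (\<Sum>j\<in>UNIV - {i}. G $ i $ j)"

definition in_degree :: "real^'n^'n \<Rightarrow> 'n \<Rightarrow> real" where
  "in_degree G i = (\<Sum>j\<in>UNIV - {i}. G $ j $ i)"

definition interaction_network :: "real^'n^'n \<Rightarrow> bool" where
  "interaction_network G \<longleftrightarrow>
     (\<forall>i j. 0 \<le> G $ i $ j) \<and> (\<forall>i. G $ i $ i = 0) \<and> (\<forall>i. out_degree G i < 1)"

definition payoff :: "real^'n^'n \<Rightarrow> 'n \<Rightarrow> ('n \<Rightarrow> real) \<Rightarrow> real \<Rightarrow> real" where
  "payoff G i a \<theta> =
     - (1 - (\<Sum>j\<in>UNIV - {i}. G $ i $ j)) * (a i - \<theta>)\<^sup>2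
     - (\<Sum>j\<in>UNIV - {i}. G $ i $ j * (a i - a j)\<^sup>2)"

definition katz_bonacich :: "real \<Rightarrow> real^'n^'n \<Rightarrow> real^'n" where
  "katz_bonacich \<gamma> G = matrix_inv (mat 1 - \<gamma> *\<^sub>R G) *v vec 1"

definition normal_noise :: "real \<Rightarrow> real measure" where
  "normal_noise \<tau> = density lborel (normal_density 0 (sqrt (1 / \<tau>)))"

text \<open>Joint law of the independent noise terms, as pairs \<open>((\<epsilon>\<^sub>j)\<^sub>j, \<epsilon>\<^sub>y)\<close>.\<close>

definition noise :: "real \<Rightarrow> real \<Rightarrow> (('n::finite \<Rightarrow> real) \<times> real) measure" where
  "noise \<tau>\<^sub>x \<tau>\<^sub>y = (\<Pi>\<^sub>M j\<in>UNIV. normal_noise \<tau>\<^sub>x) \<Otimes>\<^sub>M normal_noise \<tau>\<^sub>y"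

text \<open>
  A strategy profile \<open>s\<close> prescribes the action \<open>s i x y\<close> of agent \<open>i\<close> at the
  signals \<open>x\<close> (own) and \<open>y\<close>.  Throughout, \<open>S\<close> is the set of agents who observe
  \<open>y\<close>: all of them if \<open>y\<close> is public, only its original owner if it is kept
  private.  The strategy of an agent outside \<open>S\<close> must ignore \<open>y\<close>.
\<close>

type_synonym 'n profile = "'n \<Rightarrow> real \<Rightarrow> real \<Rightarrow> real"

definition linear_profile :: "'n set \<Rightarrow> 'n profile \<Rightarrow> bool" where
  "linear_profile S s \<longleftrightarrow>
     (\<forall>i. \<exists>\<kappa> \<alpha> \<beta>. (i \<notin> S \<longrightarrow> \<beta> = 0) \<and> (\<forall>x y. s i x y = \<kappa> + \<alpha> * x + \<beta> * y))"

text \<open>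
  The likelihood of \<open>\<theta>\<close> given what agent \<open>i\<close> observes.  Under the improper uniform
  prior, the posterior density of \<open>\<theta>\<close> is the likelihood normalised to integrate to 1.
\<close>

definition likelihood ::
  "real \<Rightarrow> real \<Rightarrow> 'n set \<Rightarrow> 'n \<Rightarrow> real \<Rightarrow> real \<Rightarrow> real \<Rightarrow> real" where
  "likelihood \<tau>\<^sub>x \<tau>\<^sub>y S i x y \<theta> =
     normal_density \<theta> (sqrt (1 / \<tau>\<^sub>x)) x *
     (if i \<in> S then normal_density \<theta> (sqrt (1 / \<tau>\<^sub>y)) y else 1)"

text \<open>
  Expected payoff of agent \<open>i\<close> from action \<open>b\<close>, conditional on the observed signals
  (\<open>y\<close> is irrelevant if \<open>i \<notin> S\<close>), when the other agents play according to \<open>s\<close>.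
  Given \<open>\<theta>\<close>, the noise terms of the signals that \<open>i\<close> does not observe keep their
  prior distribution; those of the signals that \<open>i\<close> does observe are integrated
  over without occurring in the integrand.
\<close>

definition interim_payoff ::
  "real \<Rightarrow> real \<Rightarrow> real^'n^'n \<Rightarrow> 'n set \<Rightarrow> 'n profile \<Rightarrow> 'n \<Rightarrow> real \<Rightarrow> real \<Rightarrow> real \<Rightarrow> real" where
  "interim_payoff \<tau>\<^sub>x \<tau>\<^sub>y G S s i x y b =
     (\<integral>\<theta>. (\<integral>\<omega>. payoff G i
                 (\<lambda>j. if j = i then b
                      else s j (\<theta> + fst \<omega> j) (if i \<in> S then y else \<theta> + snd \<omega>)) \<theta>
               \<partial>noise \<tau>\<^sub>x \<tau>\<^sub>y) * likelihood \<tau>\<^sub>x \<tau>\<^sub>y S i x y \<theta> \<partial>lborel)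
     / (\<integral>\<theta>. likelihood \<tau>\<^sub>x \<tau>\<^sub>y S i x y \<theta> \<partial>lborel)"

definition linear_BNE ::
  "real \<Rightarrow> real \<Rightarrow> real^'n^'n \<Rightarrow> 'n set \<Rightarrow> 'n profile \<Rightarrow> bool" where
  "linear_BNE \<tau>\<^sub>x \<tau>\<^sub>y G S s \<longleftrightarrow>
     linear_profile S s \<and>
     (\<forall>i x y b. interim_payoff \<tau>\<^sub>x \<tau>\<^sub>y G S s i x y b
                 \<le> interim_payoff \<tau>\<^sub>x \<tau>\<^sub>y G S s i x y (s i x y))"

text \<open>
  For an interaction network, positive precisions and \<open>\<gamma> = \<tau>\<^sub>x / (\<tau>\<^sub>x + \<tau>\<^sub>y)\<close>,
  linear equilibria exist and are unique in the two cases of interest: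
  with \<open>w i = (1 - \<gamma>) * katz_bonacich \<gamma> G $ i\<close>, the profile is
  \<open>s i x y = w i * y + (1 - w i) * x\<close> for \<open>S = UNIV\<close>, while for \<open>S = {k}\<close> it is
  \<open>s k x y = (1 - \<gamma>) * y + \<gamma> * x\<close> and \<open>s i x y = x\<close> for \<open>i \<noteq> k\<close>.
\<close>

definition equilibrium :: "real \<Rightarrow> real \<Rightarrow> real^'n^'n \<Rightarrow> 'n set \<Rightarrow> 'n profile" where
  "equilibrium \<tau>\<^sub>x \<tau>\<^sub>y G S = (THE s. linear_BNE \<tau>\<^sub>x \<tau>\<^sub>y G S s)"

text \<open>
  With an improper prior there is no expectation over \<open>\<theta>\<close>: the ex-ante payoff is the
  expectation over the noise terms at a given \<open>\<theta>\<close>, which in equilibrium does not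
  depend on \<open>\<theta>\<close>.
\<close>

definition equilibrium_payoff ::
  "real \<Rightarrow> real \<Rightarrow> real^'n^'n \<Rightarrow> 'n set \<Rightarrow> 'n \<Rightarrow> real \<Rightarrow> real" where
  "equilibrium_payoff \<tau>\<^sub>x \<tau>\<^sub>y G S i \<theta> =
     (\<integral>\<omega>. payoff G i
            (\<lambda>j. equilibrium \<tau>\<^sub>x \<tau>\<^sub>y G S j (\<theta> + fst \<omega> j) (\<theta> + snd \<omega>)) \<theta>
        \<partial>noise \<tau>\<^sub>x \<tau>\<^sub>y)"

definition welfare :: "real \<Rightarrow> real \<Rightarrow> real^'n^'n \<Rightarrow> 'n set \<Rightarrow> real \<Rightarrow> real" where
  "welfare \<tau>\<^sub>x \<tau>\<^sub>y G S \<theta> = (\<Sum>i\<in>UNIV. equilibrium_payoff \<tau>\<^sub>x \<tau>\<^sub>y G S i \<theta>)"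

end

theory Submission
  imports Defs
begin

text \<open>
  Conditional on agent \<open>i\<close>'s signals, the expected payoff from action \<open>b\<close> is \<open>C - (b - M)\<^sup>2\<close>,
  where \<open>M\<close> is the posterior expectation of \<open>(1 - d\<^sub>i) \<theta> + \<Sum>j. g\<^sub>i\<^sub>j a\<^sub>j\<close>.  A linear profile is
  therefore an equilibrium iff its coefficients solve a linear system, and the solution is unique
  because the row sums of \<open>G\<close> are below 1.  For an arbitrary set \<open>S\<close> of agents observing \<open>y\<close>, the
  weight on \<open>y\<close> is \<open>(1 - \<gamma>) z\<^sub>i\<close> with \<open>z\<^sub>i = 1 + \<gamma> (\<Sum>j. g\<^sub>i\<^sub>j z\<^sub>j)\<close> for \<open>i \<in> S\<close> and \<open>z\<^sub>i = 0\<close>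
  otherwise.  Eliminating the cross terms \<open>z\<^sub>i g\<^sub>i\<^sub>j z\<^sub>j\<close> by this equation, the equilibrium payoff
  becomes \<open>((1 - \<gamma>) (z\<^sub>i\<^sup>2 - \<Sum>j. g\<^sub>i\<^sub>j z\<^sub>j (z\<^sub>j - 2)) - 1 - d\<^sub>i) / \<tau>\<^sub>x\<close>, whatever \<open>S\<close> is, so that
  payoffs and welfare under two information structures are compared through \<open>z\<close> alone.
\<close>

section \<open>Integrals on product measures\<close>

lemma has_bochner_integral_pair_mult:
  fixes f :: "'a \<Rightarrow> real" and g :: "'b \<Rightarrow> real"
  assumes "sigma_finite_measure M" "sigma_finite_measure N"
    and f: "has_bochner_integral M f a" and g: "has_bochner_integral N g b"
  shows "has_bochner_integral (M \<Otimes>\<^sub>M N) (\<lambda>\<omega>. f (fst \<omega>) * g (snd \<omega>)) (a * b)"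
proof -
  interpret pair_sigma_finite M N
    using assms(1,2) by (simp add: pair_sigma_finite_def)
  have int: "integrable M f" "integrable N g" "integral\<^sup>L M f = a" "integral\<^sup>L N g = b"
    using f g by (auto simp: has_bochner_integral_iff)
  have [measurable]: "f \<in> borel_measurable M" "g \<in> borel_measurable N"
    using int by auto
  have "integrable (M \<Otimes>\<^sub>M N) (\<lambda>\<omega>. f (fst \<omega>) * g (snd \<omega>))"
    using int by (intro Fubini_integrable) (auto simp: abs_mult)
  then show ?thesis
    using int by (auto simp: has_bochner_integral_iff simp flip: integral_fst')
qed

text \<open>Coordinates are independent, so a product of functions of single coordinates integrates
  factor by factor. Every coordinate other than \<open>i\<close> and \<open>j\<close> gets the
  constant 1, whose integral is 1.\<close>

lemma has_bochner_integral_PiM_component_mult: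
  fixes f g :: "'a \<Rightarrow> real"
  assumes "prob_space M" "finite I" "i \<in> I" "j \<in> I" "i \<noteq> j"
    and f: "has_bochner_integral M f a" and g: "has_bochner_integral M g b"
  shows "has_bochner_integral (\<Pi>\<^sub>M k\<in>I. M) (\<lambda>\<omega>. f (\<omega> i) * g (\<omega> j)) (a * b)"
proof -
  interpret prob_space M by fact
  interpret product_sigma_finite "\<lambda>_. M" by unfold_locales
  define h where "h k = (if k = i then f else if k = j then g else (\<lambda>_. 1))" for k
  have h: "integrable M (h k)" for k
    using f g by (auto simp: h_def has_bochner_integral_iff)
  have I: "I = insert i (insert j (I - {i, j}))"
    using assms by auto
  have prod: "(\<Prod>k\<in>I. F k) = F i * F j" if "\<And>k. k \<noteq> i \<Longrightarrow> k \<noteq> j \<Longrightarrow> F k = 1" for F :: "_ \<Rightarrow> real"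
    by (subst I) (use assms that in \<open>simp add: mult.assoc\<close>)
  show ?thesis
    using product_integrable_prod[of I h] product_integral_prod[of I h] h f g assms
    by (auto simp: has_bochner_integral_iff prod h_def prob_space)
qed

text \<open>The marginal law of coordinate \<open>i\<close> under the product measure is
  \<open>M\<close> itself.\<close>

lemma has_bochner_integral_PiM_component:
  fixes f :: "'a \<Rightarrow> real"
  assumes "prob_space M" "finite I" "i \<in> I" and f: "has_bochner_integral M f a"
  shows "has_bochner_integral (\<Pi>\<^sub>M k\<in>I. M) (\<lambda>\<omega>. f (\<omega> i)) a"
proof -
  have "has_bochner_integral (distr (\<Pi>\<^sub>M k\<in>I. M) M (\<lambda>\<omega>. \<omega> i)) f a"
    using f distr_PiM_component[of I "\<lambda>_. M" i] assms(1,3) by simp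
  then show ?thesis
    using f \<open>i \<in> I\<close> by (auto simp: has_bochner_integral_iff integral_distr integrable_distr_eq)
qed

section \<open>Contraction and Katz-Bonacich centrality\<close>

text \<open>At an index \<open>k\<close> where \<open>\<bar>v k\<bar>\<close> is maximal, the
  hypothesis bounds \<open>\<bar>v k\<bar>\<close> by
  \<open>out_degree G k * \<bar>v k\<bar>\<close>. The out-degree is below 1, so the maximum is
  0.\<close>

lemma network_contraction:
  fixes G :: "real^'n^'n" and v :: "'n \<Rightarrow> real"
  assumes network: "interaction_network G"
    and v: "\<And>i. \<bar>v i\<bar> \<le> (\<Sum>j\<in>UNIV - {i}. G $ i $ j * \<bar>v j\<bar>)"
  shows "v i = 0"
proof -
  obtain k where k: "\<And>j. \<bar>v j\<bar> \<le> \<bar>v k\<bar>"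
    using finite_has_maximal[of "range (\<lambda>j. \<bar>v j\<bar>)"] by auto (metis linorder_linear)
  have "\<bar>v k\<bar> \<le> (\<Sum>j\<in>UNIV - {k}. G $ k $ j * \<bar>v k\<bar>)"
    using network k
    by (intro order_trans[OF v[of k]] sum_mono mult_left_mono) (auto simp: interaction_network_def)
  also have "\<dots> = out_degree G k * \<bar>v k\<bar>"
    by (simp add: out_degree_def sum_distrib_right)
  finally have "(1 - out_degree G k) * \<bar>v k\<bar> \<le> 0"
    by (simp add: algebra_simps)
  moreover have "1 - out_degree G k > 0"
    using network by (simp add: interaction_network_def)
  ultimately have "\<bar>v k\<bar> \<le> 0"
    by (simp add: mult_le_0_iff)
  with k[of i] show ?thesis by simp
qed

text \<open>Differences of solutions of the linear systems below satisfy such an equation, so this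
  gives uniqueness. The factor \<open>t\<close> varies with \<open>i\<close> because agents who do
  not observe \<open>y\<close> need the factor 0.\<close>

lemma network_contraction_scaled:
  fixes G :: "real^'n^'n" and v :: "'n \<Rightarrow> real"
  assumes network: "interaction_network G"
    and v: "\<And>i. v i = t i * (\<Sum>j\<in>UNIV - {i}. G $ i $ j * v j)"
    and t: "\<And>i. \<bar>t i\<bar> \<le> 1"
  shows "v i = 0"
proof (rule network_contraction[OF network])
  fix i
  have "\<bar>v i\<bar> = \<bar>t i\<bar> * \<bar>\<Sum>j\<in>UNIV - {i}. G $ i $ j * v j\<bar>"
    by (subst v) (rule abs_mult)
  also have "\<dots> \<le> 1 * (\<Sum>j\<in>UNIV - {i}. \<bar>G $ i $ j * v j\<bar>)"
    using t by (intro mult_mono sum_abs) auto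
  also have "\<dots> = (\<Sum>j\<in>UNIV - {i}. G $ i $ j * \<bar>v j\<bar>)"
    using network by (simp add: abs_mult interaction_network_def)
  finally show "\<bar>v i\<bar> \<le> (\<Sum>j\<in>UNIV - {i}. G $ i $ j * \<bar>v j\<bar>)" .
qed

text \<open>By contraction the matrix has trivial kernel, so it is invertible and
  \<open>matrix_inv\<close> is a true inverse. The claim is then one row of the linear
  system.\<close>

lemma katz_bonacich_eq:
  fixes G :: "real^'n^'n"
  assumes network: "interaction_network G" and \<gamma>: "\<bar>\<gamma>\<bar> \<le> 1"
  shows "katz_bonacich \<gamma> G $ i = 1 + \<gamma> * (\<Sum>j\<in>UNIV - {i}. G $ i $ j * katz_bonacich \<gamma> G $ j)"
proof -
  let ?A = "mat 1 - \<gamma> *\<^sub>R G"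
  have component: "(?A *v x) $ i = x $ i - \<gamma> * (\<Sum>j\<in>UNIV - {i}. G $ i $ j * x $ j)" for x i
  proof -
    have "(\<Sum>j\<in>UNIV. G $ i $ j * x $ j) = (\<Sum>j\<in>UNIV - {i}. G $ i $ j * x $ j)"
      using network by (intro sum.mono_neutral_right) (auto simp: interaction_network_def)
    then show ?thesis
      by (simp add: matrix_vector_mult_diff_rdistrib scaleR_matrix_vector_assoc[symmetric])
        (simp add: matrix_vector_mult_def)
  qed
  have "x = 0" if "?A *v x = 0" for x
  proof -
    have "x $ i = 0" for i
    proof (rule network_contraction_scaled[OF network])
      show "x $ i = \<gamma> * (\<Sum>j\<in>UNIV - {i}. G $ i $ j * x $ j)" for i
        using component[of x i] that by simp
      show "\<bar>\<gamma>\<bar> \<le> 1" by (fact \<gamma>)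
    qed
    then show ?thesis by (simp add: vec_eq_iff)
  qed
  then have "invertible ?A"
    by (auto simp: invertible_left_inverse matrix_left_invertible_ker)
  then have "?A *v katz_bonacich \<gamma> G = vec 1"
    \<comment> \<open>\<open>matrix_inv\<close> is a choice operator; invertibility supplies the
      existence that makes the chosen matrix an inverse.\<close>
    using someI_ex[of "\<lambda>B. ?A ** B = mat 1 \<and> B ** ?A = mat 1"]
    by (simp add: katz_bonacich_def matrix_vector_mul_assoc matrix_inv_def invertible_def)
  with component[of "katz_bonacich \<gamma> G" i] show ?thesis by simp
qed

section \<open>Gaussian moments\<close>

lemma normal_noise_moments:
  assumes "\<tau> > 0"
  shows "prob_space (normal_noise \<tau>)"
    and "has_bochner_integral (normal_noise \<tau>) (\<lambda>x. x) 0"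
    and "has_bochner_integral (normal_noise \<tau>) (\<lambda>x. x\<^sup>2) (1 / \<tau>)"
proof -
  let ?s = "sqrt (1 / \<tau>)"
  have s: "?s > 0" using assms by simp
  show "prob_space (normal_noise \<tau>)"
    unfolding normal_noise_def using s by (rule prob_space_normal_density)
  show "has_bochner_integral (normal_noise \<tau>) (\<lambda>x. x) 0"
    unfolding normal_noise_def
    using normal_moment_nz_1[OF s, of 0] s by (intro has_bochner_integral_density) auto
  show "has_bochner_integral (normal_noise \<tau>) (\<lambda>x. x\<^sup>2) (1 / \<tau>)"
    unfolding normal_noise_def
    using normal_moment_even[OF s, of 0 1] s assms
    by (intro has_bochner_integral_density) (auto simp: fact_numeral numeral_2_eq_2)
qed

lemma normal_density_precision:
  assumes "\<tau> > 0"
  shows "normal_density \<mu> (sqrt (1 / \<tau>)) x = sqrt (\<tau> / (2 * pi)) * exp (- (\<tau> / 2) * (x - \<mu>)\<^sup>2)"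
  using assms by (simp add: normal_density_def real_sqrt_divide field_simps)

text \<open>Expanding \<open>a + q * x\<close> around the mean \<mu> leaves the central moments of
  order 0, 1 and 2, which are known.\<close>

lemma has_bochner_integral_normal_affine_square:
  assumes "\<sigma> > 0"
  shows "has_bochner_integral lborel (\<lambda>x. normal_density \<mu> \<sigma> x * (a + q * x)\<^sup>2)
    ((a + q * \<mu>)\<^sup>2 + q\<^sup>2 * \<sigma>\<^sup>2)"
proof -
  note m0 = normal_moment_even[OF assms, of \<mu> 0, simplified]
    and m1 = normal_moment_odd[OF assms, of \<mu> 0, simplified]
    and m2 = normal_moment_even[OF assms, of \<mu> 1, simplified]
  have "has_bochner_integral lborel (\<lambda>x. (a + q * \<mu>)\<^sup>2 * normal_density \<mu> \<sigma> x
      + (2 * (a + q * \<mu>) * q) * (normal_density \<mu> \<sigma> x * (x - \<mu>))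
      + q\<^sup>2 * (normal_density \<mu> \<sigma> x * (x - \<mu>)\<^sup>2))
    ((a + q * \<mu>)\<^sup>2 * 1 + (2 * (a + q * \<mu>) * q) * 0 + q\<^sup>2 * \<sigma>\<^sup>2)"
    using m0 m1 m2
    by (intro has_bochner_integral_add has_bochner_integral_mult_right) (auto simp: fact_numeral)
  then show ?thesis
    by (rule has_bochner_integral_cong[THEN iffD1, rotated -1])
      (auto simp: power2_eq_square algebra_simps)
qed

section \<open>Moments of the joint noise\<close>

context
  fixes \<tau>\<^sub>x \<tau>\<^sub>y :: real
  assumes \<tau>: "\<tau>\<^sub>x > 0" "\<tau>\<^sub>y > 0"
begin

text \<open>Mixed moments factor by independence, and vanish because each factor has mean 0.\<close>

lemma noise_moments:
  fixes i j :: "'n::finite"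
  defines "M \<equiv> (noise \<tau>\<^sub>x \<tau>\<^sub>y :: (('n \<Rightarrow> real) \<times> real) measure)"
  shows "prob_space M"
    and "has_bochner_integral M (\<lambda>\<omega>. fst \<omega> i) 0"
    and "has_bochner_integral M (\<lambda>\<omega>. (fst \<omega> i)\<^sup>2) (1 / \<tau>\<^sub>x)"
    and "i \<noteq> j \<Longrightarrow> has_bochner_integral M (\<lambda>\<omega>. fst \<omega> i * fst \<omega> j) 0"
    and "has_bochner_integral M snd 0"
    and "has_bochner_integral M (\<lambda>\<omega>. (snd \<omega>)\<^sup>2) (1 / \<tau>\<^sub>y)"
    and "has_bochner_integral M (\<lambda>\<omega>. fst \<omega> i * snd \<omega>) 0"
proof -
  let ?P = "\<Pi>\<^sub>M j\<in>(UNIV :: 'n set). normal_noise \<tau>\<^sub>x"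
  note mx = normal_noise_moments[OF \<tau>(1)] and my = normal_noise_moments[OF \<tau>(2)]
  interpret P: prob_space ?P using mx(1) by (rule prob_space_PiM)
  interpret Y: prob_space "normal_noise \<tau>\<^sub>y" by (fact my(1))
  have M: "M = ?P \<Otimes>\<^sub>M normal_noise \<tau>\<^sub>y" by (simp add: M_def noise_def)
  show "prob_space M"
    unfolding M by (intro prob_space_pair P.prob_space_axioms my)
  note pair = has_bochner_integral_pair_mult[OF P.sigma_finite_measure_axioms Y.sigma_finite_measure_axioms]
  note comp = has_bochner_integral_PiM_component[OF mx(1), of UNIV i, simplified]
    and comp2 = has_bochner_integral_PiM_component_mult[OF mx(1), of UNIV i j, simplified]
  have 1: "has_bochner_integral ?P (\<lambda>_. 1) (1 :: real)" "has_bochner_integral (normal_noise \<tau>\<^sub>y) (\<lambda>_. 1) (1 :: real)"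
    by (simp_all add: has_bochner_integral_iff P.prob_space Y.prob_space)
  show "has_bochner_integral M (\<lambda>\<omega>. fst \<omega> i) 0"
    unfolding M using pair[OF comp[OF mx(2)] 1(2)] by simp
  show "has_bochner_integral M (\<lambda>\<omega>. (fst \<omega> i)\<^sup>2) (1 / \<tau>\<^sub>x)"
    unfolding M using pair[OF comp[OF mx(3)] 1(2)] by simp
  show "has_bochner_integral M (\<lambda>\<omega>. fst \<omega> i * fst \<omega> j) 0" if "i \<noteq> j"
    unfolding M using pair[OF comp2[OF that mx(2,2)] 1(2)] by simp
  show "has_bochner_integral M snd 0"
    unfolding M using pair[OF 1(1) my(2)] by simp
  show "has_bochner_integral M (\<lambda>\<omega>. (snd \<omega>)\<^sup>2) (1 / \<tau>\<^sub>y)"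
    unfolding M using pair[OF 1(1) my(3)] by simp
  show "has_bochner_integral M (\<lambda>\<omega>. fst \<omega> i * snd \<omega>) 0"
    unfolding M using pair[OF comp[OF mx(2)] my(2)] by simp
qed

lemma has_bochner_integral_noise_const:
  "has_bochner_integral (noise \<tau>\<^sub>x \<tau>\<^sub>y :: (('n::finite \<Rightarrow> real) \<times> real) measure) (\<lambda>_. a) (a :: real)"
proof -
  interpret prob_space "noise \<tau>\<^sub>x \<tau>\<^sub>y :: (('n \<Rightarrow> real) \<times> real) measure" by (rule noise_moments)
  show ?thesis by (simp add: has_bochner_integral_iff prob_space)
qed

text \<open>After expansion only the squares survive. The alternative \<open>q = 0\<close> permits
  \<open>i = j\<close>, which serves expressions involving a single agent's noise.\<close>

lemma has_bochner_integral_noise_affine_square: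
  fixes i j :: "'n::finite"
  assumes "i \<noteq> j \<or> q = 0"
  shows "has_bochner_integral (noise \<tau>\<^sub>x \<tau>\<^sub>y)
    (\<lambda>\<omega>. (a + p * fst \<omega> i + q * fst \<omega> j + r * snd \<omega>)\<^sup>2) (a\<^sup>2 + (p\<^sup>2 + q\<^sup>2) / \<tau>\<^sub>x + r\<^sup>2 / \<tau>\<^sub>y)"
proof -
  let ?X = "\<lambda>k \<omega>. (fst \<omega> :: 'n \<Rightarrow> real) k"
  note m = noise_moments[where 'n='n]
  have "has_bochner_integral (noise \<tau>\<^sub>x \<tau>\<^sub>y)
    (\<lambda>\<omega>. a\<^sup>2 + p\<^sup>2 * (?X i \<omega>)\<^sup>2 + q\<^sup>2 * (?X j \<omega>)\<^sup>2 + r\<^sup>2 * (snd \<omega>)\<^sup>2 + (2*a*p) * ?X i \<omega>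
      + (2*a*q) * ?X j \<omega> + (2*a*r) * snd \<omega> + (2*p*q) * (?X i \<omega> * ?X j \<omega>)
      + (2*p*r) * (?X i \<omega> * snd \<omega>) + (2*q*r) * (?X j \<omega> * snd \<omega>))
    (a\<^sup>2 + p\<^sup>2 * (1 / \<tau>\<^sub>x) + q\<^sup>2 * (1 / \<tau>\<^sub>x) + r\<^sup>2 * (1 / \<tau>\<^sub>y) + (2*a*p) * 0
      + (2*a*q) * 0 + (2*a*r) * 0 + (2*p*q) * 0 + (2*p*r) * 0 + (2*q*r) * 0)"
    by (intro has_bochner_integral_add has_bochner_integral_mult_right
        has_bochner_integral_noise_const m) (use assms in auto)
  then show ?thesis
    by (rule has_bochner_integral_cong[THEN iffD1, rotated -1])
      (auto simp: power2_eq_square algebra_simps add_divide_distrib)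
qed

section \<open>Posterior beliefs and best replies\<close>

definition posterior_mean :: "'n set \<Rightarrow> 'n \<Rightarrow> real \<Rightarrow> real \<Rightarrow> real" where
  "posterior_mean S i x y = (if i \<in> S then (\<tau>\<^sub>x * x + \<tau>\<^sub>y * y) / (\<tau>\<^sub>x + \<tau>\<^sub>y) else x)"

text \<open>As a function of \<theta> the likelihood is a Gaussian density up to a factor
  \<open>K\<close>. With the flat prior this density is the posterior, so expectations given the
  signals reduce to Gaussian moments.\<close>

lemma likelihood_eq_posterior:
  obtains K \<sigma> where "K > 0" "\<sigma> > 0"
    "\<And>\<theta>. likelihood \<tau>\<^sub>x \<tau>\<^sub>y S i x y \<theta> = K * normal_density (posterior_mean S i x y) \<sigma> \<theta>"
proof (cases "i \<in> S")
  case False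
  show ?thesis
    by (rule that[of 1 "sqrt (1 / \<tau>\<^sub>x)"])
      (use False \<tau> in \<open>auto simp: likelihood_def posterior_mean_def normal_density_def power2_commute\<close>)
next
  case True
  define T where "T = \<tau>\<^sub>x + \<tau>\<^sub>y"
  define m where "m = posterior_mean S i x y"
  have T: "T > 0" using \<tau> by (simp add: T_def)
  have m: "m = (\<tau>\<^sub>x * x + \<tau>\<^sub>y * y) / T"
    using True by (simp add: m_def posterior_mean_def T_def)
  \<comment> \<open>\<open>K\<close> collects what does not depend on \<theta>: the ratio of the
    normalizing constants and the exponential in \<open>x - y\<close> left over from completing the
    square.\<close>
  define K where "K = sqrt (\<tau>\<^sub>x / (2 * pi)) * sqrt (\<tau>\<^sub>y / (2 * pi)) / sqrt (T / (2 * pi))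
    * exp (- (\<tau>\<^sub>x * \<tau>\<^sub>y / (2 * T)) * (x - y)\<^sup>2)"
  show ?thesis
  proof (rule that[of K "sqrt (1 / T)"])
    show "K > 0" "sqrt (1 / T) > 0" using \<tau> T by (auto simp: K_def)
    fix \<theta>
    have "- (\<tau>\<^sub>x / 2) * (x - \<theta>)\<^sup>2 + - (\<tau>\<^sub>y / 2) * (y - \<theta>)\<^sup>2
      = - (\<tau>\<^sub>x * \<tau>\<^sub>y / (2 * T)) * (x - y)\<^sup>2 + - (T / 2) * (\<theta> - m)\<^sup>2"
      using T unfolding m by (simp add: field_simps) (simp add: T_def power2_eq_square algebra_simps)
    then have "exp (- (\<tau>\<^sub>x / 2) * (x - \<theta>)\<^sup>2) * exp (- (\<tau>\<^sub>y / 2) * (y - \<theta>)\<^sup>2)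
      = exp (- (\<tau>\<^sub>x * \<tau>\<^sub>y / (2 * T)) * (x - y)\<^sup>2) * exp (- (T / 2) * (\<theta> - m)\<^sup>2)"
      by (simp only: exp_add[symmetric])
    then show "likelihood \<tau>\<^sub>x \<tau>\<^sub>y S i x y \<theta>
        = K * normal_density (posterior_mean S i x y) (sqrt (1 / T)) \<theta>"
      using True T unfolding likelihood_def normal_density_precision[OF \<tau>(1)]
        normal_density_precision[OF \<tau>(2)] normal_density_precision[OF T] K_def m_def[symmetric]
      by (simp add: mult.assoc mult.left_commute)
  qed
qed

text \<open>The other agents \<open>j\<close> play \<open>\<kappa> j + \<alpha> j * x + \<beta> j * y\<close>.\<close>

definition best_reply :: "real^'n^'n \<Rightarrow> 'n set \<Rightarrow> 'n \<Rightarrow> ('n \<Rightarrow> real) \<Rightarrow> ('n \<Rightarrow> real) \<Rightarrow>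
    ('n \<Rightarrow> real) \<Rightarrow> real \<Rightarrow> real \<Rightarrow> real" where
  "best_reply G S i \<kappa> \<alpha> \<beta> x y =
    (let m = posterior_mean S i x y in
      (1 - out_degree G i) * m
      + (\<Sum>j\<in>UNIV - {i}. G $ i $ j * (\<kappa> j + \<alpha> j * m + \<beta> j * (if i \<in> S then y else m))))"

lemma interim_payoff_eq:
  fixes G :: "real^'n^'n"
  assumes s: "\<And>i x y. s i x y = \<kappa> i + \<alpha> i * x + \<beta> i * y"
  obtains C where
    "\<And>b. interim_payoff \<tau>\<^sub>x \<tau>\<^sub>y G S s i x y b = C - (b - best_reply G S i \<kappa> \<alpha> \<beta> x y)\<^sup>2"
proof -
  define m where "m = posterior_mean S i x y"
  obtain K \<sigma> where K: "K > 0" and \<sigma>: "\<sigma> > 0"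
    and L: "\<And>\<theta>. likelihood \<tau>\<^sub>x \<tau>\<^sub>y S i x y \<theta> = K * normal_density m \<sigma> \<theta>"
    using likelihood_eq_posterior[of S i x y] unfolding m_def by blast
  \<comment> \<open>Given \<theta> and the signals of \<open>i\<close>, the action of
    \<open>j\<close> has mean \<open>p j + q j * \<theta>\<close> and variance \<open>v j\<close>.
    An observed \<open>y\<close> is a constant and enters \<open>p\<close>; an unobserved one is
    \<theta> plus noise and enters \<open>q\<close> and \<open>v\<close>.\<close>
  define p where "p j = \<kappa> j + (if i \<in> S then \<beta> j * y else 0)" for j
  define q where "q j = \<alpha> j + (if i \<in> S then 0 else \<beta> j)" for j
  define v where "v j = (\<alpha> j)\<^sup>2 / \<tau>\<^sub>x + (if i \<in> S then 0 else (\<beta> j)\<^sup>2) / \<tau>\<^sub>y" for j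
  let ?d = "out_degree G i" and ?J = "UNIV - {i}"
  have inner: "(\<integral>\<omega>. payoff G i (\<lambda>j. if j = i then b
        else s j (\<theta> + fst \<omega> j) (if i \<in> S then y else \<theta> + snd \<omega>)) \<theta> \<partial>noise \<tau>\<^sub>x \<tau>\<^sub>y)
      = - (1 - ?d) * (b - \<theta>)\<^sup>2 - (\<Sum>j\<in>?J. G $ i $ j * ((b - p j - q j * \<theta>)\<^sup>2 + v j))" for b \<theta>
  proof -
    have sq: "has_bochner_integral (noise \<tau>\<^sub>x \<tau>\<^sub>y)
        (\<lambda>\<omega>. (b - s j (\<theta> + fst \<omega> j) (if i \<in> S then y else \<theta> + snd \<omega>))\<^sup>2)
        ((b - p j - q j * \<theta>)\<^sup>2 + v j)" if "j \<in> ?J" for j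
    proof -
      have "i \<noteq> j" using that by auto
      \<comment> \<open>The noise of \<open>i\<close> is only a placeholder here, with coefficient
        0.\<close>
      from has_bochner_integral_noise_affine_square[OF disjI1[OF this], of "b - p j - q j * \<theta>" 0 "- \<alpha> j"
          "if i \<in> S then 0 else - \<beta> j"]
      have "has_bochner_integral (noise \<tau>\<^sub>x \<tau>\<^sub>y) (\<lambda>\<omega>. (b - p j - q j * \<theta> + 0 * fst \<omega> i
          + (- \<alpha> j) * fst \<omega> j + (if i \<in> S then 0 else - \<beta> j) * snd \<omega>)\<^sup>2)
          ((b - p j - q j * \<theta>)\<^sup>2 + v j)"
        by (simp add: v_def add.assoc split: if_splits)
      then show ?thesis
        by (rule has_bochner_integral_cong[THEN iffD1, rotated -1])
          (auto simp: s p_def q_def algebra_simps)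
    qed
    have "has_bochner_integral (noise \<tau>\<^sub>x \<tau>\<^sub>y) (\<lambda>\<omega>. - (1 - ?d) * (b - \<theta>)\<^sup>2 - (\<Sum>j\<in>?J. G $ i $ j *
        (b - s j (\<theta> + fst \<omega> j) (if i \<in> S then y else \<theta> + snd \<omega>))\<^sup>2))
      (- (1 - ?d) * (b - \<theta>)\<^sup>2 - (\<Sum>j\<in>?J. G $ i $ j * ((b - p j - q j * \<theta>)\<^sup>2 + v j)))"
      by (intro has_bochner_integral_diff has_bochner_integral_sum has_bochner_integral_mult_right
          has_bochner_integral_noise_const sq)
    moreover have "payoff G i (\<lambda>j. if j = i then b
        else s j (\<theta> + fst \<omega> j) (if i \<in> S then y else \<theta> + snd \<omega>)) \<theta> =
        - (1 - ?d) * (b - \<theta>)\<^sup>2 - (\<Sum>j\<in>?J. G $ i $ j *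
        (b - s j (\<theta> + fst \<omega> j) (if i \<in> S then y else \<theta> + snd \<omega>))\<^sup>2)" for \<omega>
      unfolding payoff_def out_degree_def by (auto intro!: sum.cong)
    ultimately show ?thesis
      by (simp add: has_bochner_integral_iff)
  qed
  \<comment> \<open>The expected payoff at \<open>b = 0\<close>, plus the square of the best
    reply.\<close>
  define C where "C = - (1 - ?d) * (m\<^sup>2 + \<sigma>\<^sup>2)
    - (\<Sum>j\<in>?J. G $ i $ j * ((p j + q j * m)\<^sup>2 + (q j)\<^sup>2 * \<sigma>\<^sup>2 + v j))
    + (best_reply G S i \<kappa> \<alpha> \<beta> x y)\<^sup>2"
  have "interim_payoff \<tau>\<^sub>x \<tau>\<^sub>y G S s i x y b = C - (b - best_reply G S i \<kappa> \<alpha> \<beta> x y)\<^sup>2" for b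
  proof -
    let ?N = "normal_density m \<sigma>"
    have N: "has_bochner_integral lborel ?N 1"
      using \<sigma> by (simp add: has_bochner_integral_iff)
    let ?f = "\<lambda>\<theta>. - (1 - ?d) * (b - \<theta>)\<^sup>2 - (\<Sum>j\<in>?J. G $ i $ j * ((b - p j - q j * \<theta>)\<^sup>2 + v j))"
    let ?V = "- (1 - ?d) * ((b - m)\<^sup>2 + \<sigma>\<^sup>2)
        - (\<Sum>j\<in>?J. G $ i $ j * ((b - (p j + q j * m))\<^sup>2 + (q j)\<^sup>2 * \<sigma>\<^sup>2 + v j))"
    have "has_bochner_integral lborel (\<lambda>\<theta>. - (1 - ?d) * (?N \<theta> * (b + (-1) * \<theta>)\<^sup>2)
        - (\<Sum>j\<in>?J. G $ i $ j * (?N \<theta> * (b - p j + (- q j) * \<theta>)\<^sup>2 + v j * ?N \<theta>)))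
      (- (1 - ?d) * ((b + (-1) * m)\<^sup>2 + (-1)\<^sup>2 * \<sigma>\<^sup>2)
        - (\<Sum>j\<in>?J. G $ i $ j * (((b - p j + (- q j) * m)\<^sup>2 + (- q j)\<^sup>2 * \<sigma>\<^sup>2) + v j * 1)))"
      by (intro has_bochner_integral_diff has_bochner_integral_sum has_bochner_integral_add
          has_bochner_integral_mult_right has_bochner_integral_normal_affine_square \<sigma> N)
    moreover have "- (1 - ?d) * (?N \<theta> * (b + (-1) * \<theta>)\<^sup>2)
        - (\<Sum>j\<in>?J. G $ i $ j * (?N \<theta> * (b - p j + (- q j) * \<theta>)\<^sup>2 + v j * ?N \<theta>))
      = ?f \<theta> * ?N \<theta>" for \<theta>
    proof -
      have "(\<Sum>j\<in>?J. G $ i $ j * (?N \<theta> * (b - p j + (- q j) * \<theta>)\<^sup>2 + v j * ?N \<theta>))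
        = (\<Sum>j\<in>?J. G $ i $ j * ((b - p j - q j * \<theta>)\<^sup>2 + v j)) * ?N \<theta>"
        unfolding sum_distrib_right by (intro sum.cong) (auto simp: algebra_simps)
      moreover have "- (1 - ?d) * (?N \<theta> * (b + (-1) * \<theta>)\<^sup>2) - X * ?N \<theta>
        = (- (1 - ?d) * (b - \<theta>)\<^sup>2 - X) * ?N \<theta>" for X
        by (simp add: algebra_simps)
      ultimately show ?thesis
        by (simp only:)
    qed
    ultimately have V: "has_bochner_integral lborel (\<lambda>\<theta>. ?f \<theta> * ?N \<theta>) ?V"
      by (simp add: diff_diff_eq)
    \<comment> \<open>The factor \<open>K\<close> occurs in numerator and denominator of the interim
      payoff and cancels.\<close>
    have "(\<integral>\<theta>. ?f \<theta> * (K * ?N \<theta>) \<partial>lborel) = K * ?V"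
      by (simp only: mult.left_commute[of _ K] integral_mult_right_zero
          has_bochner_integral_integral_eq[OF V])
    moreover have "(\<integral>\<theta>. K * ?N \<theta> \<partial>lborel) = K"
      using N by (simp add: has_bochner_integral_iff)
    ultimately have "interim_payoff \<tau>\<^sub>x \<tau>\<^sub>y G S s i x y b = ?V"
      using K unfolding interim_payoff_def inner L by simp
    also have "\<dots> = C - (b - best_reply G S i \<kappa> \<alpha> \<beta> x y)\<^sup>2"
    proof -
      \<comment> \<open>\<open>r j\<close> is the action of \<open>j\<close> that \<open>i\<close>
        expects. In total \<open>b\<^sup>2\<close> has coefficient
        \<open>- (1 - ?d) - ?d = - 1\<close>, so the square completes exactly.\<close>
      define r where "r j = p j + q j * m" for j
      define A B where "A = (\<Sum>j\<in>?J. G $ i $ j * r j)"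
        and "B = (\<Sum>j\<in>?J. G $ i $ j * ((r j)\<^sup>2 + (q j)\<^sup>2 * \<sigma>\<^sup>2 + v j))"
      have br: "best_reply G S i \<kappa> \<alpha> \<beta> x y = (1 - ?d) * m + A"
        by (auto simp: best_reply_def Let_def m_def[symmetric] A_def r_def p_def q_def distrib_left
            distrib_right intro!: sum.cong)
      have "(\<Sum>j\<in>?J. G $ i $ j * ((b - r j)\<^sup>2 + (q j)\<^sup>2 * \<sigma>\<^sup>2 + v j))
        = (\<Sum>j\<in>?J. b\<^sup>2 * G $ i $ j - 2 * b * (G $ i $ j * r j)
            + G $ i $ j * ((r j)\<^sup>2 + (q j)\<^sup>2 * \<sigma>\<^sup>2 + v j))"
        by (intro sum.cong) (auto simp: power2_eq_square algebra_simps)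
      also have "\<dots> = b\<^sup>2 * ?d - 2 * b * A + B"
        by (simp add: sum.distrib sum_subtractf sum_distrib_left out_degree_def A_def B_def)
      finally show ?thesis
        unfolding C_def r_def[symmetric] B_def[symmetric] br
        by (simp add: power2_eq_square algebra_simps)
    qed
    finally show ?thesis .
  qed
  then show ?thesis by (rule that)
qed

text \<open>The interim payoff is a strictly concave quadratic in \<open>b\<close>, whose only
  maximizer is the best reply.\<close>

lemma linear_BNE_iff:
  fixes G :: "real^'n^'n"
  assumes "\<And>i x y. s i x y = \<kappa> i + \<alpha> i * x + \<beta> i * y" and "\<And>i. i \<notin> S \<Longrightarrow> \<beta> i = 0"
  shows "linear_BNE \<tau>\<^sub>x \<tau>\<^sub>y G S s \<longleftrightarrow> (\<forall>i x y. s i x y = best_reply G S i \<kappa> \<alpha> \<beta> x y)"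
proof -
  have "linear_profile S s"
    unfolding linear_profile_def using assms by blast
  moreover have "(\<forall>b. interim_payoff \<tau>\<^sub>x \<tau>\<^sub>y G S s i x y b \<le> interim_payoff \<tau>\<^sub>x \<tau>\<^sub>y G S s i x y (s i x y))
      \<longleftrightarrow> s i x y = best_reply G S i \<kappa> \<alpha> \<beta> x y" (is "?L \<longleftrightarrow> ?R") for i x y
  proof -
    obtain C where C: "\<And>b. interim_payoff \<tau>\<^sub>x \<tau>\<^sub>y G S s i x y b = C - (b - best_reply G S i \<kappa> \<alpha> \<beta> x y)\<^sup>2"
      using interim_payoff_eq[of s \<kappa> \<alpha> \<beta> G S i x y, OF assms(1)] by blast
    show ?thesis
    proof
      assume ?L
      \<comment> \<open>Optimality is tested against the deviation to the best reply itself.\<close>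
      then have "C - (best_reply G S i \<kappa> \<alpha> \<beta> x y - best_reply G S i \<kappa> \<alpha> \<beta> x y)\<^sup>2
          \<le> C - (s i x y - best_reply G S i \<kappa> \<alpha> \<beta> x y)\<^sup>2"
        unfolding C by blast
      then have "(s i x y - best_reply G S i \<kappa> \<alpha> \<beta> x y)\<^sup>2 \<le> 0"
        by simp
      then show ?R by simp
    qed (simp add: C)
  qed
  ultimately show ?thesis
    unfolding linear_BNE_def by blast
qed

section \<open>Equilibrium, payoffs and welfare\<close>

context
  fixes G :: "real^'n^'n" and \<gamma> :: real
  assumes network: "interaction_network G" and \<gamma>_eq: "\<gamma> = \<tau>\<^sub>x / (\<tau>\<^sub>x + \<tau>\<^sub>y)"
begin

lemma \<gamma>_bounds: "0 < \<gamma>" "\<gamma> < 1"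
  using \<tau> by (auto simp: \<gamma>_eq)

lemma posterior_mean_observer:
  assumes "i \<in> S"
  shows "posterior_mean S i x y = \<gamma> * x + (1 - \<gamma>) * y"
proof -
  have "1 - \<gamma> = \<tau>\<^sub>y / (\<tau>\<^sub>x + \<tau>\<^sub>y)"
    using \<tau> by (simp add: \<gamma>_eq field_simps)
  then show ?thesis
    using assms by (simp add: posterior_mean_def \<gamma>_eq add_divide_distrib)
qed

text \<open>
  The vector \<open>z\<close> specialises to the Katz-Bonacich centralities if everyone
  observes \<open>y\<close>, and to a unit vector if a single agent does.
\<close>

context
  fixes S :: "'n set" and z :: "'n \<Rightarrow> real"
  assumes z: "\<And>i. z i = (if i \<in> S then 1 + \<gamma> * (\<Sum>j\<in>UNIV - {i}. G $ i $ j * z j) else 0)"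
begin

text \<open>Existence is a direct check of the best-reply equations. For uniqueness, these equations
  at the signal pairs (0,0), (1,1) and (0,1) determine the intercepts, the sums of the weights and
  the weights on \<open>y\<close>, each by contraction.\<close>

lemma equilibrium_eq:
  "equilibrium \<tau>\<^sub>x \<tau>\<^sub>y G S = (\<lambda>i x y. (1 - \<gamma>) * z i * y + (1 - (1 - \<gamma>) * z i) * x)"
  unfolding equilibrium_def
proof (rule the_equality)
  let ?J = "\<lambda>i. UNIV - {i}"
  define w where "w i = (1 - \<gamma>) * z i" for i
  have w: "w i = (1 - \<gamma>) + \<gamma> * (\<Sum>j\<in>?J i. G $ i $ j * w j)" if "i \<in> S" for i
  proof -
    have "(\<Sum>j\<in>?J i. G $ i $ j * w j) = (1 - \<gamma>) * (\<Sum>j\<in>?J i. G $ i $ j * z j)"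
      by (simp add: w_def sum_distrib_left mult_ac)
    moreover have "w i = (1 - \<gamma>) + \<gamma> * ((1 - \<gamma>) * (\<Sum>j\<in>?J i. G $ i $ j * z j))"
      using z[of i] that by (simp add: w_def algebra_simps)
    ultimately show ?thesis by simp
  qed
  have w0: "w i = 0" if "i \<notin> S" for i
    using z[of i] that by (simp add: w_def)
  \<comment> \<open>If the weights of every agent sum to 1 and intercepts vanish, only the weights
    on \<open>y\<close> matter. The correction term is 0 for agents outside
    \<open>S\<close>.\<close>
  have br: "best_reply G S i (\<lambda>_. 0) (\<lambda>j. 1 - \<beta> j) \<beta> x y
      = posterior_mean S i x y + ((if i \<in> S then y else posterior_mean S i x y)
        - posterior_mean S i x y) * (\<Sum>j\<in>?J i. G $ i $ j * \<beta> j)" for \<beta> i x y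
    by (simp add: best_reply_def Let_def algebra_simps sum.distrib sum_subtractf
        sum_distrib_left out_degree_def)
  show "linear_BNE \<tau>\<^sub>x \<tau>\<^sub>y G S (\<lambda>i x y. (1 - \<gamma>) * z i * y + (1 - (1 - \<gamma>) * z i) * x)"
  proof (subst linear_BNE_iff[where \<kappa> = "\<lambda>_. 0" and \<alpha> = "\<lambda>i. 1 - w i" and \<beta> = w])
    have "w i * y + (1 - w i) * x = best_reply G S i (\<lambda>_. 0) (\<lambda>i. 1 - w i) w x y" for i x y
    proof (cases "i \<in> S")
      case True
      define A where "A = (\<Sum>j\<in>?J i. G $ i $ j * w j)"
      have wi: "w i = 1 - \<gamma> + \<gamma> * A"
        using w[OF True] by (simp add: A_def)
      show ?thesis
        unfolding br posterior_mean_observer[OF True] A_def[symmetric] wi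
        using True by (simp add: algebra_simps)
    next
      case False
      then show ?thesis
        unfolding br using w0[OF False] by (simp add: posterior_mean_def)
    qed
    then show "\<forall>i x y. (1 - \<gamma>) * z i * y + (1 - (1 - \<gamma>) * z i) * x
        = best_reply G S i (\<lambda>_. 0) (\<lambda>i. 1 - w i) w x y"
      by (simp add: w_def)
  qed (use w0 in \<open>auto simp: w_def\<close>)
  fix s assume s: "linear_BNE \<tau>\<^sub>x \<tau>\<^sub>y G S s"
  then have "\<forall>i. \<exists>\<kappa> \<alpha> \<beta>. (i \<notin> S \<longrightarrow> \<beta> = 0) \<and> (\<forall>x y. s i x y = \<kappa> + \<alpha> * x + \<beta> * y)"
    by (simp add: linear_BNE_def linear_profile_def)
  then obtain \<kappa> \<alpha> \<beta> where \<beta>0: "\<And>i. i \<notin> S \<Longrightarrow> \<beta> i = 0"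
    and lin: "\<And>i x y. s i x y = \<kappa> i + \<alpha> i * x + \<beta> i * y"
    by metis
  have BNE: "\<kappa> i + \<alpha> i * x + \<beta> i * y = best_reply G S i \<kappa> \<alpha> \<beta> x y" for i x y
    using s linear_BNE_iff[of s \<kappa> \<alpha> \<beta> S G, OF lin \<beta>0] by (simp add: lin)
  \<comment> \<open>At equal signals observers and non-observers form the same posterior mean, so
    one equation covers both.\<close>
  have diag: "posterior_mean S i x x = x" for i x
    using \<tau> by (simp add: posterior_mean_def flip: distrib_right)
  have \<kappa>: "\<kappa> i = 0" for i
  proof (rule network_contraction_scaled[OF network])
    show "\<kappa> i = 1 * (\<Sum>j\<in>?J i. G $ i $ j * \<kappa> j)" for i
      using BNE[of i 0 0] by (simp add: best_reply_def diag)
  qed simp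
  have \<alpha>: "\<alpha> i = 1 - \<beta> i" for i
  proof -
    have "\<alpha> i + \<beta> i - 1 = 0"
    proof (rule network_contraction_scaled[OF network])
      show "\<alpha> i + \<beta> i - 1 = 1 * (\<Sum>j\<in>?J i. G $ i $ j * (\<alpha> j + \<beta> j - 1))" for i
        using BNE[of i 1 1] by (simp add: best_reply_def diag \<kappa> out_degree_def
            algebra_simps sum.distrib sum_subtractf)
    qed simp
    then show ?thesis by simp
  qed
  have \<beta>: "\<beta> i = w i" for i
  proof -
    have "\<beta> i - w i = 0"
    \<comment> \<open>At signals (0,1) an observer's posterior mean is \<open>1 - \<gamma>\<close>,
      which gives \<beta> the same equation as \<open>w\<close>. Outside \<open>S\<close> both
      vanish.\<close>
    proof (rule network_contraction_scaled[OF network, where t = "\<lambda>i. if i \<in> S then \<gamma> else 0"])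
      fix i
      show "\<beta> i - w i = (if i \<in> S then \<gamma> else 0) * (\<Sum>j\<in>?J i. G $ i $ j * (\<beta> j - w j))"
      proof (cases "i \<in> S")
        case True
        have "\<alpha> = (\<lambda>j. 1 - \<beta> j)" "\<kappa> = (\<lambda>_. 0)" using \<alpha> \<kappa> by auto
        with BNE[of i 0 1] have "\<beta> i = (1 - \<gamma>) + \<gamma> * (\<Sum>j\<in>?J i. G $ i $ j * \<beta> j)"
          using True by (simp add: br posterior_mean_observer)
        with w[OF True] True show ?thesis
          by (simp add: right_diff_distrib sum_subtractf)
      qed (simp add: \<beta>0 w0)
    qed (use \<gamma>_bounds in auto)
    then show ?thesis by simp
  qed
  show "s = (\<lambda>i x y. (1 - \<gamma>) * z i * y + (1 - (1 - \<gamma>) * z i) * x)"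
    by (intro ext) (simp add: lin \<kappa> \<alpha> \<beta> w_def)
qed

text \<open>Deviations from \<theta> and differences of actions are linear in the noise, so the
  payoff is quadratic in the weights. The equation for \<open>z\<close> then removes the products of
  \<open>z i\<close> with \<open>z j\<close>.\<close>

lemma equilibrium_payoff_eq:
  "equilibrium_payoff \<tau>\<^sub>x \<tau>\<^sub>y G S i \<theta>
    = ((1 - \<gamma>) * ((z i)\<^sup>2 - (\<Sum>j\<in>UNIV - {i}. G $ i $ j * z j * (z j - 2)))
        - 1 - out_degree G i) / \<tau>\<^sub>x"
proof -
  let ?J = "UNIV - {i}" and ?d = "out_degree G i"
  define w where "w j = (1 - \<gamma>) * z j" for j
  let ?a = "\<lambda>\<omega> j. w j * (\<theta> + snd \<omega>) + (1 - w j) * (\<theta> + fst \<omega> j)"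
  have dev: "has_bochner_integral (noise \<tau>\<^sub>x \<tau>\<^sub>y) (\<lambda>\<omega>. (?a \<omega> i - \<theta>)\<^sup>2)
      ((1 - w i)\<^sup>2 / \<tau>\<^sub>x + (w i)\<^sup>2 / \<tau>\<^sub>y)"
    using has_bochner_integral_noise_affine_square[of i i 0 0 "1 - w i" "w i"]
    by (simp add: algebra_simps)
  have diff: "has_bochner_integral (noise \<tau>\<^sub>x \<tau>\<^sub>y) (\<lambda>\<omega>. (?a \<omega> i - ?a \<omega> j)\<^sup>2)
      (((1 - w i)\<^sup>2 + (1 - w j)\<^sup>2) / \<tau>\<^sub>x + (w i - w j)\<^sup>2 / \<tau>\<^sub>y)" if "j \<in> ?J" for j
    using has_bochner_integral_noise_affine_square[of i j "- (1 - w j)" 0 "1 - w i" "w i - w j"] that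
    by (simp add: algebra_simps power2_commute[of 1 "w j"])
  have "has_bochner_integral (noise \<tau>\<^sub>x \<tau>\<^sub>y)
      (\<lambda>\<omega>. - (1 - ?d) * (?a \<omega> i - \<theta>)\<^sup>2 - (\<Sum>j\<in>?J. G $ i $ j * (?a \<omega> i - ?a \<omega> j)\<^sup>2))
      (- (1 - ?d) * ((1 - w i)\<^sup>2 / \<tau>\<^sub>x + (w i)\<^sup>2 / \<tau>\<^sub>y) - (\<Sum>j\<in>?J. G $ i $ j *
        (((1 - w i)\<^sup>2 + (1 - w j)\<^sup>2) / \<tau>\<^sub>x + (w i - w j)\<^sup>2 / \<tau>\<^sub>y)))"
    by (intro has_bochner_integral_diff has_bochner_integral_sum has_bochner_integral_mult_right
        dev diff)
  then have "equilibrium_payoff \<tau>\<^sub>x \<tau>\<^sub>y G S i \<theta>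
      = - (1 - ?d) * ((1 - w i)\<^sup>2 / \<tau>\<^sub>x + (w i)\<^sup>2 / \<tau>\<^sub>y) - (\<Sum>j\<in>?J. G $ i $ j *
        (((1 - w i)\<^sup>2 + (1 - w j)\<^sup>2) / \<tau>\<^sub>x + (w i - w j)\<^sup>2 / \<tau>\<^sub>y))"
    unfolding equilibrium_payoff_def equilibrium_eq payoff_def out_degree_def w_def
    by (rule has_bochner_integral_integral_eq)
  also have "\<dots> = (- (1 - ?d) * (1 + (1 - \<gamma>) * z i * (z i - 2)) - (\<Sum>j\<in>?J.
      G $ i $ j * (1 + (1 - \<gamma>) * z i * (z i - 2)) + G $ i $ j
      + (1 - \<gamma>) * (G $ i $ j * z j * (z j - 2)) - 2 * (1 - \<gamma>) * z i * \<gamma> * (G $ i $ j * z j))) / \<tau>\<^sub>x"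
  proof -
    \<comment> \<open>Since
      \<open>\<tau>\<^sub>x * (1 - \<gamma>) = \<tau>\<^sub>y * \<gamma>\<close>, the variance due
      to \<open>y\<close> can be expressed over the common denominator
      \<open>\<tau>\<^sub>x\<close>.\<close>
    have y: "((1 - \<gamma>) * u)\<^sup>2 / \<tau>\<^sub>y = \<gamma> * (1 - \<gamma>) * u\<^sup>2 / \<tau>\<^sub>x" for u
    proof -
      have "\<tau>\<^sub>x * (1 - \<gamma>) = \<tau>\<^sub>y * \<gamma>"
        using \<tau> by (simp add: \<gamma>_eq field_simps)
      then have "(1 - \<gamma>) / \<tau>\<^sub>y = \<gamma> / \<tau>\<^sub>x"
        using \<tau> by (simp add: field_simps)
      then have "((1 - \<gamma>) / \<tau>\<^sub>y) * ((1 - \<gamma>) * u\<^sup>2) = (\<gamma> / \<tau>\<^sub>x) * ((1 - \<gamma>) * u\<^sup>2)"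
        by simp
      then show ?thesis
        by (simp add: power2_eq_square mult_ac)
    qed
    have 1: "(1 - w i)\<^sup>2 / \<tau>\<^sub>x + (w i)\<^sup>2 / \<tau>\<^sub>y = (1 + (1 - \<gamma>) * z i * (z i - 2)) / \<tau>\<^sub>x"
      unfolding w_def y by (simp add: power2_eq_square algebra_simps flip: add_divide_distrib)
    have 2: "((1 - w i)\<^sup>2 + (1 - w j)\<^sup>2) / \<tau>\<^sub>x + (w i - w j)\<^sup>2 / \<tau>\<^sub>y
      = ((1 + (1 - \<gamma>) * z i * (z i - 2)) + 1 + (1 - \<gamma>) * (z j * (z j - 2))
          - 2 * (1 - \<gamma>) * z i * \<gamma> * z j) / \<tau>\<^sub>x" for j
      unfolding w_def right_diff_distrib[of "1 - \<gamma>", symmetric] y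
      by (simp add: power2_eq_square algebra_simps flip: add_divide_distrib)
    show ?thesis
      unfolding 1 2 diff_divide_distrib sum_divide_distrib
      by (intro arg_cong2[where f = minus] sum.cong) 
        (auto simp: algebra_simps add_divide_distrib diff_divide_distrib)
  qed
  also have "\<dots> = (- (1 + (1 - \<gamma>) * z i * (z i - 2)) - ?d
      - (1 - \<gamma>) * (\<Sum>j\<in>?J. G $ i $ j * z j * (z j - 2))
      + 2 * (1 - \<gamma>) * (z i * (\<gamma> * (\<Sum>j\<in>?J. G $ i $ j * z j)))) / \<tau>\<^sub>x"
  proof -
    \<comment> \<open>Summation yields \<open>?d * h\<close>, which cancels against the same term in
      \<open>- (1 - ?d) * h\<close>.\<close>
    define h where "h = 1 + (1 - \<gamma>) * z i * (z i - 2)"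
    have "(\<Sum>j\<in>?J. G $ i $ j * h + G $ i $ j
      + (1 - \<gamma>) * (G $ i $ j * z j * (z j - 2)) - 2 * (1 - \<gamma>) * z i * \<gamma> * (G $ i $ j * z j))
      = ?d * h + ?d + (1 - \<gamma>) * (\<Sum>j\<in>?J. G $ i $ j * z j * (z j - 2))
        - 2 * (1 - \<gamma>) * z i * \<gamma> * (\<Sum>j\<in>?J. G $ i $ j * z j)"
      unfolding out_degree_def sum.distrib sum_subtractf sum_distrib_left sum_distrib_right ..
    then show ?thesis
      unfolding h_def[symmetric] by (simp add: algebra_simps)
  qed
  \<comment> \<open>For an observer the inner factor is \<open>z i - 1\<close>; for the others
    \<open>z i = 0\<close>, so both sides vanish.\<close>
  also have "z i * (\<gamma> * (\<Sum>j\<in>?J. G $ i $ j * z j)) = z i * (z i - 1)"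
    using z[of i] by (cases "i \<in> S") simp_all
  finally show ?thesis
    by (simp add: power2_eq_square algebra_simps)
qed

text \<open>Summing payoffs over all agents and exchanging the double sum collects the weights that
  others place on \<open>j\<close>, which turns rows of \<open>G\<close> into in-degrees.\<close>

lemma welfare_eq:
  "welfare \<tau>\<^sub>x \<tau>\<^sub>y G S \<theta>
    = ((1 - \<gamma>) * (\<Sum>i\<in>UNIV. z i * ((1 - in_degree G i) * z i + 2 * in_degree G i))
        - (\<Sum>i\<in>UNIV. 1 + out_degree G i)) / \<tau>\<^sub>x"
proof -
  \<comment> \<open>Full index sets make the range of the inner sum independent of the outer index,
    as the exchange requires.\<close>
  have off: "(\<Sum>j\<in>UNIV - {i}. f j) = (\<Sum>j\<in>UNIV. if j \<noteq> i then f j else 0)" for f :: "'n \<Rightarrow> real" and i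
    by (intro sum.mono_neutral_cong_left) auto
  have "(\<Sum>i\<in>UNIV. \<Sum>j\<in>UNIV - {i}. G $ i $ j * z j * (z j - 2))
      = (\<Sum>j\<in>UNIV. \<Sum>i\<in>UNIV - {j}. G $ i $ j * z j * (z j - 2))"
    unfolding off by (subst sum.swap) (auto intro!: sum.cong)
  also have "\<dots> = (\<Sum>j\<in>UNIV. in_degree G j * z j * (z j - 2))"
    by (simp add: in_degree_def sum_distrib_right mult.assoc)
  finally have "(\<Sum>i\<in>UNIV. (z i)\<^sup>2 - (\<Sum>j\<in>UNIV - {i}. G $ i $ j * z j * (z j - 2)))
      = (\<Sum>i\<in>UNIV. z i * ((1 - in_degree G i) * z i + 2 * in_degree G i))"
    unfolding sum_subtractf
    by (simp add: power2_eq_square algebra_simps sum.distrib sum_subtractf flip: sum_distrib_left)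
  then show ?thesis
    unfolding welfare_def equilibrium_payoff_eq sum_divide_distrib[symmetric]
    by (simp add: sum_subtractf sum.distrib flip: sum_distrib_left)
qed

end

end

end

section \<open>Comparison of public and private information\<close>

theorem proposition4:
  fixes G :: "real^'n^'n" and agent1 :: 'n and \<tau>\<^sub>x \<tau>\<^sub>y \<gamma> \<theta> :: real and c :: "real^'n"
  assumes "CARD('n) \<ge> 2"
    and "interaction_network G"
    and "\<tau>\<^sub>x > 0" and "\<tau>\<^sub>y > 0"
    and "\<gamma> = \<tau>\<^sub>x / (\<tau>\<^sub>x + \<tau>\<^sub>y)"
    and "c = katz_bonacich \<gamma> G"
  shows
    "(equilibrium_payoff \<tau>\<^sub>x \<tau>\<^sub>y G UNIV agent1 \<theta>
        < equilibrium_payoff \<tau>\<^sub>x \<tau>\<^sub>y G {agent1} agent1 \<theta> \<and>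
      welfare \<tau>\<^sub>x \<tau>\<^sub>y G {agent1} \<theta> < welfare \<tau>\<^sub>x \<tau>\<^sub>y G UNIV \<theta>)
     \<longleftrightarrow>
     ((c $ agent1)\<^sup>2 - (\<Sum>j\<in>UNIV - {agent1}. G $ agent1 $ j * (c $ j) * (c $ j - 2)) < 1 \<and>
      1 + in_degree G agent1
        < (\<Sum>i\<in>UNIV. c $ i * ((1 - in_degree G i) * c $ i + 2 * in_degree G i)))"
proof -
  let ?k = agent1
  let ?F = "\<lambda>z. (z ?k)\<^sup>2 - (\<Sum>j\<in>UNIV - {?k}. G $ ?k $ j * z j * (z j - 2))"
  let ?W = "\<lambda>z. \<Sum>i\<in>UNIV. z i * ((1 - in_degree G i) * z i + 2 * in_degree G i)"
  \<comment> \<open>The vector \<open>z\<close> when only \<open>agent1\<close> observes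
    \<open>y\<close>: the others have weight 0, so the network sum in its own equation
    vanishes.\<close>
  define e :: "'n \<Rightarrow> real" where "e i = (if i = ?k then 1 else 0)" for i
  have \<gamma>: "1 - \<gamma> > 0" "\<bar>\<gamma>\<bar> \<le> 1"
    using \<gamma>_bounds[OF assms(3,4,2,5)] by simp_all
  \<comment> \<open>The trivial case distinction puts the centrality equation into the form required
    of \<open>z\<close> with \<open>S = UNIV\<close>.\<close>
  have c: "c $ i = (if i \<in> UNIV then 1 + \<gamma> * (\<Sum>j\<in>UNIV - {i}. G $ i $ j * c $ j) else 0)" for i
    using katz_bonacich_eq[OF assms(2) \<gamma>(2), of i] by (simp add: assms(6))
  have e: "e i = (if i \<in> {?k} then 1 + \<gamma> * (\<Sum>j\<in>UNIV - {i}. G $ i $ j * e j) else 0)" for i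
    by (auto simp: e_def intro!: sum.neutral)
  have eF: "?F e = 1"
    by (simp add: e_def)
  have "e i * ((1 - in_degree G i) * e i + 2 * in_degree G i)
      = (if i = ?k then 1 + in_degree G ?k else 0)" for i
    by (simp add: e_def)
  then have eW: "?W e = 1 + in_degree G ?k"
    by simp
  note payoff = equilibrium_payoff_eq[OF assms(3,4,2,5)] and welfare = welfare_eq[OF assms(3,4,2,5)]
  \<comment> \<open>The subtracted degree terms \<open>r\<close> do not depend on the information
    structure, so only \<open>?F\<close> and \<open>?W\<close> at \<open>c\<close> and
    \<open>e\<close> are compared.\<close>
  have less_iff: "((1 - \<gamma>) * a - r) / \<tau>\<^sub>x < ((1 - \<gamma>) * b - r) / \<tau>\<^sub>x \<longleftrightarrow> a < b" for a b r
    using \<gamma>(1) assms(3) by (simp add: divide_less_cancel)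
  have "equilibrium_payoff \<tau>\<^sub>x \<tau>\<^sub>y G UNIV ?k \<theta> < equilibrium_payoff \<tau>\<^sub>x \<tau>\<^sub>y G {?k} ?k \<theta> \<longleftrightarrow> ?F (($) c) < 1"
    unfolding payoff[OF c] payoff[OF e] eF diff_diff_eq less_iff ..
  moreover have "welfare \<tau>\<^sub>x \<tau>\<^sub>y G {?k} \<theta> < welfare \<tau>\<^sub>x \<tau>\<^sub>y G UNIV \<theta> \<longleftrightarrow> 1 + in_degree G ?k < ?W (($) c)"
    unfolding welfare[OF c] welfare[OF e] eW less_iff ..
  ultimately show ?thesis
    by simp
qed

end
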